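(* Let $0<q<1$, $x\in[0,1]$, and let $n\ge k\ge 0$ be integers. Then the $q$-Bernstein basis function $b_{k,n}^q(x)$ is the coefficient of $\dfrac{t^n}{[n]_q!}$ in the expansion, as a power series in $t$, of $$\frac{x^k t^k}{[k]_q!}\,e_q\big((1-q)(1-x)_q t\big).$$
   Context: For an integer $k\ge 0$ and $0<q<1$, $[k]_q=\frac{1-q^k}{1-q}$, and $[k]_q!=[k]_q[k-1]_q\cdots[1]_q$ for $k\ge 1$, with $[0]_q!=1$. For integers $n\ge k\ge 0$, $\left[{n\atop k}\right]_q=\frac{[n]_q!}{[k]_q!\,[n-k]_q!}$. For $a,b\in\mathbb{R}$ and an integer $m\ge 0$, $(a-b)_q^m=\prod_{s=0}^{m-1}(a-q^s b)$, with the empty product equal to $1$; in particular $(1-x)_q^m=\prod_{s=0}^{m-1}(1-q^s x)$. The $q$-Bernstein basis function is $b_{k,n}^q(x)=\left[{n\atop k}\right]_q x^k(1-x)_q^{n-k}$ for $x\in[0,1]$. The $q$-exponential function is $e_q(z)=\sum_{m=0}^\infty \frac{z^m}{(1-q)(1-q^2)\cdots(1-q^m)}$, so that $e_q((1-q)z)=\sum_{m=0}^\infty \frac{z^m}{[m]_q!}$. Convention for the symbolic argument: in $e_q\big((1-q)(1-x)_q t\big)$ the $m$-th power of the symbol $(1-x)_q$ is understood as $(1-x)_q^m=\prod_{s=0}^{m-1}(1-q^s x)$ (not as the ordinary power $(1-x)^m$), that is, $$e_q\big((1-q)(1-x)_q t\big)=\sum_{m=0}^\infty \frac{(1-x)_q^m\,t^m}{[m]_q!}.$$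 *)

theory Defs
  imports "HOL-Analysis.FPS_Convergence"
begin

definition q_int :: "real \<Rightarrow> nat \<Rightarrow> real" where
  "q_int q k = (1 - q ^ k) / (1 - q)"

definition q_fact :: "real \<Rightarrow> nat \<Rightarrow> real" where
  "q_fact q k = (\<Prod>i=1..k. q_int q i)"

text \<open>Only meaningful for \<open>k \<le> n\<close>; subtraction is truncated otherwise.\<close>
definition q_binomial :: "real \<Rightarrow> nat \<Rightarrow> nat \<Rightarrow> real" where
  "q_binomial q n k = q_fact q n / (q_fact q k * q_fact q (n - k))"

text \<open>\<open>q_diff_pow q a b m\<close> is $(a-b)_q^m$.\<close>
definition q_diff_pow :: "real \<Rightarrow> real \<Rightarrow> real \<Rightarrow> nat \<Rightarrow> real" where
  "q_diff_pow q a b m = (\<Prod>s<m. a - q ^ s * b)"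

definition q_bernstein :: "real \<Rightarrow> nat \<Rightarrow> nat \<Rightarrow> real \<Rightarrow> real" where
  "q_bernstein q k n x = q_binomial q n k * x ^ k * q_diff_pow q 1 x (n - k)"

definition q_exp_fps :: "real \<Rightarrow> real fps" where
  "q_exp_fps q = Abs_fps (\<lambda>m. 1 / (\<Prod>i=1..m. 1 - q ^ i))"

text \<open>The series $A(ut)$ in $t$, where the $m$-th power of the symbol $u$ is read as \<open>u m\<close>.\<close>
definition fps_umbral :: "real fps \<Rightarrow> (nat \<Rightarrow> real) \<Rightarrow> real fps" where
  "fps_umbral A u = Abs_fps (\<lambda>m. fps_nth A m * u m)"

text \<open>The series $e_q((1-q)(1-x)_q t)$ in $t$, with symbolic powers $(1-x)_q^m$, and the
  corresponding function of $t$.\<close>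
definition q_exp_symb_fps :: "real \<Rightarrow> real \<Rightarrow> real fps" where
  "q_exp_symb_fps q x = fps_umbral (q_exp_fps q) (\<lambda>m. (1 - q) ^ m * q_diff_pow q 1 x m)"

definition q_exp_symb :: "real \<Rightarrow> real \<Rightarrow> real \<Rightarrow> real" where
  "q_exp_symb q x t = (\<Sum>m. q_diff_pow q 1 x m * t ^ m / q_fact q m)"

lemma q_exp_symb_fps_nth:
  assumes "q \<noteq> 1"
  shows "fps_nth (q_exp_symb_fps q x) m = q_diff_pow q 1 x m / q_fact q m"
  using assms
  by (simp add: q_exp_symb_fps_def fps_umbral_def q_exp_fps_def q_fact_def q_int_def
      prod_dividef)

text \<open>Coefficient of $t^n/[n]_q!$ in a power series in $t$.\<close>
definition q_egf_coeff :: "real \<Rightarrow> real fps \<Rightarrow> nat \<Rightarrow> real" where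
  "q_egf_coeff q F n = q_fact q n * fps_nth F n"

end

theory Submission
  imports Defs
begin

text \<open>Multiplying by \<open>t^k\<close> shifts coefficients by k, so the coefficient of
  \<open>t^n\<close> in the product is \<open>x^k / [k]_q!\<close> times the coefficient of index
  n-k of the symbolic exponential, which is \<open>(1-x)_q^(n-k) / [n-k]_q!\<close>. Scaling by
  \<open>[n]_q!\<close> assembles the q-binomial. For the series to represent the function near 0,
  its radius of convergence must be positive. This follows from \<open>abs_q_diff_pow_le_1\<close>
  and \<open>q_fact_ge_1\<close>, which bound all coefficients by 1 in absolute value.\<close>

lemma q_int_ge_1:
  assumes "0 < q" "q < 1" "k \<ge> 1"
  shows "q_int q k \<ge> 1"
proof -
  have "q ^ k \<le> q ^ 1"
    using assms by (intro power_decreasing) auto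
  then show ?thesis
    using assms by (simp add: q_int_def)
qed

lemma q_fact_ge_1:
  assumes "0 < q" "q < 1"
  shows "q_fact q k \<ge> 1"
  unfolding q_fact_def using assms by (intro prod_ge_1 q_int_ge_1) auto

lemma abs_q_diff_pow_le_1:
  assumes "0 < q" "q < 1" "x \<in> {0..1}"
  shows "\<bar>q_diff_pow q 1 x m\<bar> \<le> 1"
proof -
  have "\<bar>1 - q ^ s * x\<bar> \<le> 1" for s
  proof -
    have "q ^ s \<le> 1"
      using assms by (intro power_le_one) auto
    then have "q ^ s * x \<le> 1"
      using assms by (intro mult_le_one) auto
    moreover have "0 \<le> q ^ s * x"
      using assms by simp
    ultimately show ?thesis
      by linarith
  qed
  then show ?thesis
    unfolding q_diff_pow_def abs_prod by (intro prod_le_1) auto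
qed

lemma fps_conv_radius_q_exp_symb_pos:
  assumes "0 < q" "q < 1" "x \<in> {0..1}"
  shows "fps_conv_radius (q_exp_symb_fps q x) > 0"
proof -
  let ?a = "fps_nth (q_exp_symb_fps q x)"
  have "norm (?a m) \<le> 1" for m
  proof -
    have "\<bar>q_diff_pow q 1 x m\<bar> \<le> q_fact q m"
      using abs_q_diff_pow_le_1[OF assms, of m] q_fact_ge_1[OF assms(1,2), of m] by linarith
    then show ?thesis
      using assms q_fact_ge_1[OF assms(1,2), of m] by (simp add: q_exp_symb_fps_nth abs_divide)
  qed
  \<comment> \<open>Any point strictly between 0 and 1 would serve in place of 1/2: bounded
    coefficients give a geometric majorant there.\<close>
  then have "norm (?a m * (1 / 2) ^ m) \<le> (1 / 2) ^ m" for m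
    using mult_right_mono[of "\<bar>?a m\<bar>" 1 "(1 / 2) ^ m"] by (simp add: abs_mult)
  then have "summable (\<lambda>m. ?a m * (1 / 2) ^ m)"
    by (intro summable_comparison_test'[OF summable_geometric]) auto
  then have "conv_radius ?a \<ge> ereal (norm (1 / 2 :: real))"
    by (rule conv_radius_geI)
  then show ?thesis
    unfolding fps_conv_radius_def by (rule less_le_trans[rotated]) simp
qed

text \<open>Both functions are infinite sums with the same terms, so they agree at every t, whether
  or not the sum converges; the positive radius makes this a genuine expansion at 0.\<close>

lemma q_exp_symb_has_fps_expansion:
  assumes "0 < q" "q < 1" "x \<in> {0..1}"
  shows "q_exp_symb q x has_fps_expansion q_exp_symb_fps q x"
proof -
  have "eval_fps (q_exp_symb_fps q x) = q_exp_symb q x"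
    using assms by (simp add: fun_eq_iff eval_fps_def q_exp_symb_def q_exp_symb_fps_nth)
  then show ?thesis
    using fps_conv_radius_q_exp_symb_pos[OF assms] by (simp add: has_fps_expansion_def)
qed

theorem theorem1:
  fixes q x :: real and k n :: nat
  assumes "0 < q" and "q < 1" and "x \<in> {0..1}" and "k \<le> n"
  shows "let F = fps_const (x ^ k / q_fact q k) * fps_X ^ k * q_exp_symb_fps q x in
    (\<lambda>t. x ^ k * t ^ k / q_fact q k * q_exp_symb q x t) has_fps_expansion F \<and>
    q_egf_coeff q F n = q_bernstein q k n x"
proof -
  let ?F = "fps_const (x ^ k / q_fact q k) * fps_X ^ k * q_exp_symb_fps q x"
  \<comment> \<open>The scalar is put in front so that the function factors exactly as
    \<open>?F\<close> does and the introduction rules apply.\<close>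
  have "(\<lambda>t. x ^ k / q_fact q k * t ^ k * q_exp_symb q x t) has_fps_expansion ?F"
    using q_exp_symb_has_fps_expansion[OF assms(1-3)]
    by (intro fps_expansion_intros)
  moreover have "q_egf_coeff q ?F n = q_bernstein q k n x"
    \<comment> \<open>\<open>k \<le> n\<close> selects the nonzero branch of
      \<open>fps_X_power_mult_nth\<close>.\<close>
    using assms
    by (simp add: q_egf_coeff_def q_bernstein_def q_binomial_def mult.assoc
        fps_X_power_mult_nth q_exp_symb_fps_nth)
  ultimately show ?thesis
    by (simp add: Let_def)
qed

end
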